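(* Let $f:\mathbb{R}\to\mathbb{R}$ be a smooth function with $f''>0$ everywhere, and let $\mathcal{M}^1_{6,f}=(\mathbb{R}^6,g^1_{6,f})$, where in coordinates $(x,y,z_1,z_2,\tilde y,\tilde x)$ the non-zero components of the metric are, up to symmetry, $$g^1_{6,f}(\partial_x,\partial_{\tilde x})=g^1_{6,f}(\partial_y,\partial_{\tilde y})=g^1_{6,f}(\partial_{z_1},\partial_{z_1})=g^1_{6,f}(\partial_{z_2},\partial_{z_2})=1,\qquad g^1_{6,f}(\partial_x,\partial_x)=-2(yz_1+f(y)z_2).$$ Then $\mathcal{M}^1_{6,f}$ is weakly $1$-curvature homogeneous but not $1$-curvature homogeneous.
   Context: For a pseudo-Riemannian manifold $\mathcal{M}=(M,g)$ with Levi-Civita connection $\nabla$, use the metric to lower indices and regard $\nabla^iR\in\otimes^{4+i}T^*M$. $\mathcal{M}$ is $k$-curvature homogeneous if for any two points $P,Q\in M$ there is a linear isomorphism $\Psi:T_PM\to T_QM$ with $\Psi^*g_Q=g_P$ and $\Psi^*\nabla^iR_Q=\nabla^iR_P$ for $0\le i\le k$. $\mathcal{M}$ is weakly $k$-curvature homogeneous if there exist a real vector space $V$ and tensors $A^i\in\otimes^{4+i}V^*$, $0\le i\le k$, with the appropriate curvature symmetries (those of $\nabla^iR$), such that for every $P\in M$ there is a linear isomorphism $\Phi:T_PM\to V$ with $\Phi^*A^i=\nabla^iR_P$ for $0\le i\le k$. There is no requirement that $\Phi$ preserve an inner product. *)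

theory Defs
  imports "HOL-Analysis.Analysis"
begin

text \<open>
  All manifolds here have a vector space \<^typ>\<open>'a::euclidean_space\<close> as underlying manifold, so
  every tangent space is identified with \<^typ>\<open>'a\<close> and a vector \<open>u\<close> also stands for the constant
  (coordinate) vector field with value \<open>u\<close>.  Covariant tensors of rank \<open>r\<close> take their arguments
  as a list of length \<open>r\<close>; values on lists of any other length carry no meaning.  The inner product
  of \<^typ>\<open>'a\<close> plays no role.
\<close>

type_synonym 'a metric = "'a \<Rightarrow> 'a \<Rightarrow> 'a \<Rightarrow> real"
type_synonym 'a tensor_field = "'a \<Rightarrow> 'a list \<Rightarrow> real"

definition dir_deriv :: "'a \<Rightarrow> ('a::real_normed_vector \<Rightarrow> 'b::real_normed_vector) \<Rightarrow> 'a \<Rightarrow> 'b" where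
  "dir_deriv u F P = frechet_derivative F (at P) u"

definition smooth :: "('a::real_normed_vector \<Rightarrow> 'b::real_normed_vector) \<Rightarrow> bool" where
  "smooth F \<longleftrightarrow> (\<forall>us P. fold dir_deriv us F differentiable (at P))"

definition pseudo_riemannian :: "'a::euclidean_space metric \<Rightarrow> bool" where
  "pseudo_riemannian g \<longleftrightarrow>
     (\<forall>P. bilinear (g P)) \<and>
     (\<forall>P u v. g P u v = g P v u) \<and>
     (\<forall>P u. (\<forall>v. g P u v = 0) \<longrightarrow> u = 0) \<and>
     (\<forall>u v. smooth (\<lambda>P. g P u v))"


subsection \<open>Levi-Civita connection and curvature\<close>

text \<open>
  A connection is given by its Christoffel map \<open>\<Gamma>\<close>: \<open>\<Gamma> P u v\<close> is the covariant derivative at \<open>P\<close>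
  of the constant vector field \<open>v\<close> in direction \<open>u\<close>.
\<close>

type_synonym 'a connection = "'a \<Rightarrow> 'a \<Rightarrow> 'a \<Rightarrow> 'a"

definition cov_deriv :: "'a::euclidean_space connection \<Rightarrow> 'a \<Rightarrow> ('a \<Rightarrow> 'a) \<Rightarrow> 'a \<Rightarrow> 'a" where
  "cov_deriv \<Gamma> u X P = dir_deriv u X P + \<Gamma> P u (X P)"

text \<open>Constant vector fields commute, so vanishing torsion is symmetry of \<open>\<Gamma> P\<close>.\<close>

definition is_levi_civita :: "'a::euclidean_space metric \<Rightarrow> 'a connection \<Rightarrow> bool" where
  "is_levi_civita g \<Gamma> \<longleftrightarrow>
     (\<forall>P. bilinear (\<Gamma> P)) \<and>
     (\<forall>P u v. \<Gamma> P u v = \<Gamma> P v u) \<and>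
     (\<forall>P u v w. dir_deriv u (\<lambda>Q. g Q v w) P = g P (\<Gamma> P u v) w + g P v (\<Gamma> P u w))"

definition levi_civita :: "'a::euclidean_space metric \<Rightarrow> 'a connection" where
  "levi_civita g = (THE \<Gamma>. is_levi_civita g \<Gamma>)"

text \<open>There is no bracket term, since \<open>u\<close> and \<open>v\<close> are extended to commuting vector fields.\<close>

definition curvature_op :: "'a::euclidean_space connection \<Rightarrow> 'a \<Rightarrow> 'a \<Rightarrow> 'a \<Rightarrow> 'a \<Rightarrow> 'a" where
  "curvature_op \<Gamma> P u v w =
     cov_deriv \<Gamma> u (cov_deriv \<Gamma> v (\<lambda>_. w)) P - cov_deriv \<Gamma> v (cov_deriv \<Gamma> u (\<lambda>_. w)) P"

text \<open>The direction of differentiation is the last argument of the derived tensor.\<close>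

definition cov_deriv_tensor ::
    "'a::euclidean_space connection \<Rightarrow> 'a tensor_field \<Rightarrow> 'a tensor_field" where
  "cov_deriv_tensor \<Gamma> T P vs =
     (let us = butlast vs; w = last vs in
        dir_deriv w (\<lambda>Q. T Q us) P - (\<Sum>p<length us. T P (us[p := \<Gamma> P w (us ! p)])))"

primrec nabla_curvature :: "'a::euclidean_space metric \<Rightarrow> nat \<Rightarrow> 'a tensor_field" where
  "nabla_curvature g 0 =
     (\<lambda>P vs. g P (curvature_op (levi_civita g) P (vs ! 0) (vs ! 1) (vs ! 2)) (vs ! 3))"
| "nabla_curvature g (Suc i) = cov_deriv_tensor (levi_civita g) (nabla_curvature g i)"


subsection \<open>Curvature homogeneity\<close>

definition curvature_homogeneous :: "nat \<Rightarrow> 'a::euclidean_space metric \<Rightarrow> bool" where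
  "curvature_homogeneous k g \<longleftrightarrow>
     (\<forall>P Q. \<exists>\<Psi>::'a \<Rightarrow> 'a. linear \<Psi> \<and> bij \<Psi> \<and>
        (\<forall>u v. g Q (\<Psi> u) (\<Psi> v) = g P u v) \<and>
        (\<forall>i\<le>k. \<forall>vs. length vs = 4 + i \<longrightarrow>
           nabla_curvature g i Q (map \<Psi> vs) = nabla_curvature g i P vs))"

definition multilinear_form :: "nat \<Rightarrow> ('v::real_vector list \<Rightarrow> real) \<Rightarrow> bool" where
  "multilinear_form r A \<longleftrightarrow>
     (\<forall>vs p. length vs = r \<longrightarrow> p < r \<longrightarrow> linear (\<lambda>v. A (vs[p := v])))"

text \<open>
  The symmetries of the \<open>i\<close>-th covariant derivative of a curvature tensor: the algebraic curvature
  symmetries in the first four arguments and, for \<open>i > 0\<close>, the second Bianchi identity, in which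
  the fifth argument is the direction of the first differentiation.
\<close>

definition curvature_symmetries :: "nat \<Rightarrow> ('v::real_vector list \<Rightarrow> real) \<Rightarrow> bool" where
  "curvature_symmetries i A \<longleftrightarrow>
     (\<forall>a b c d vs. length vs = i \<longrightarrow>
        A ([a, b, c, d] @ vs) = - A ([b, a, c, d] @ vs) \<and>
        A ([a, b, c, d] @ vs) = A ([c, d, a, b] @ vs) \<and>
        A ([a, b, c, d] @ vs) + A ([b, c, a, d] @ vs) + A ([c, a, b, d] @ vs) = 0) \<and>
     (\<forall>a b c d e vs. Suc (length vs) = i \<longrightarrow>
        A ([a, b, c, d, e] @ vs) + A ([b, e, c, d, a] @ vs) + A ([e, a, c, d, b] @ vs) = 0)"

definition curvature_model ::
    "nat \<Rightarrow> (nat \<Rightarrow> 'v::real_vector list \<Rightarrow> real) \<Rightarrow> 'a::euclidean_space metric \<Rightarrow> bool" where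
  "curvature_model k A g \<longleftrightarrow>
     (\<forall>i\<le>k. multilinear_form (4 + i) (A i) \<and> curvature_symmetries i (A i)) \<and>
     (\<forall>P. \<exists>\<Phi>::'a \<Rightarrow> 'v. linear \<Phi> \<and> bij \<Phi> \<and>
        (\<forall>i\<le>k. \<forall>vs. length vs = 4 + i \<longrightarrow> A i (map \<Phi> vs) = nabla_curvature g i P vs))"

text \<open>
  One cannot quantify existentially over the type of the model space \<open>V\<close>.  Any \<open>V\<close> that occurs is
  linearly isomorphic to the tangent spaces, so \<open>V\<close> is taken to be \<^typ>\<open>'a\<close>; by
  \<open>weakly_curvature_homogeneousI\<close> below, no generality is lost.
\<close>

definition weakly_curvature_homogeneous :: "nat \<Rightarrow> 'a::euclidean_space metric \<Rightarrow> bool" where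
  "weakly_curvature_homogeneous k g \<longleftrightarrow> (\<exists>A :: nat \<Rightarrow> 'a list \<Rightarrow> real. curvature_model k A g)"

lemma weakly_curvature_homogeneousI:
  fixes A :: "nat \<Rightarrow> 'v::real_vector list \<Rightarrow> real" and g :: "'a::euclidean_space metric"
  assumes "curvature_model k A g"
  shows "weakly_curvature_homogeneous k g"
proof -
  obtain F :: "'a \<Rightarrow> 'v" where F: "linear F" "bij F"
    using assms unfolding curvature_model_def by blast
  define B where "B i vs = A i (map F vs)" for i vs
  have inv: "linear (inv F)" "bij (inv F)"
  proof -
    have "inv F (F x) = x" "F (inv F y) = y" for x y
      using F(2) by (simp_all add: bij_is_inj bij_is_surj surj_f_inv_f)
    note i = this
    show "linear (inv F)"
    proof (rule linearI)
      fix x y c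
      have "inv F (F (inv F x) + F (inv F y)) = inv F x + inv F y"
        unfolding linear_add[OF F(1), symmetric] by (rule i)
      then show "inv F (x + y) = inv F x + inv F y" by (simp add: i)
      have "inv F (c *\<^sub>R F (inv F x)) = c *\<^sub>R inv F x"
        unfolding linear_scale[OF F(1), symmetric] by (rule i)
      then show "inv F (c *\<^sub>R x) = c *\<^sub>R inv F x" by (simp add: i)
    qed
  qed (simp add: F(2) bij_imp_bij_inv)
  have 1: "multilinear_form (4 + i) (B i)" if "i \<le> k" for i
    unfolding multilinear_form_def
  proof (intro allI impI)
    fix vs :: "'a list" and p assume "length vs = 4 + i" "p < 4 + i"
    then have "linear (\<lambda>v. A i ((map F vs)[p := v]))"
      using assms that unfolding curvature_model_def multilinear_form_def by simp
    then have "linear ((\<lambda>v. A i ((map F vs)[p := v])) \<circ> F)"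
      using F(1) linear_compose by blast
    then show "linear (\<lambda>v. B i (vs[p := v]))"
      by (simp add: B_def o_def map_update)
  qed
  have 2: "curvature_symmetries i (B i)" if "i \<le> k" for i
  proof -
    have c: "curvature_symmetries i (A i)"
      using assms that unfolding curvature_model_def by blast
    show ?thesis
      unfolding curvature_symmetries_def B_def map_append list.map
      by (intro conjI allI impI;
          rule c[unfolded curvature_symmetries_def, THEN conjunct1, rule_format, THEN conjunct1]
            c[unfolded curvature_symmetries_def, THEN conjunct1, rule_format, THEN conjunct2, THEN conjunct1]
            c[unfolded curvature_symmetries_def, THEN conjunct1, rule_format, THEN conjunct2, THEN conjunct2]
            c[unfolded curvature_symmetries_def, THEN conjunct2, rule_format]; simp)
  qed
  have 3: "\<exists>\<Phi>::'a \<Rightarrow> 'a. linear \<Phi> \<and> bij \<Phi> \<and>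
        (\<forall>i\<le>k. \<forall>vs. length vs = 4 + i \<longrightarrow> B i (map \<Phi> vs) = nabla_curvature g i P vs)" for P
  proof -
    obtain G :: "'a \<Rightarrow> 'v" where G: "linear G" "bij G"
      "\<forall>i\<le>k. \<forall>vs. length vs = 4 + i \<longrightarrow> A i (map G vs) = nabla_curvature g i P vs"
      using assms unfolding curvature_model_def by blast
    have "F \<circ> (inv F \<circ> G) = G"
      using F(2) by (simp add: o_assoc[symmetric] fun_eq_iff bij_is_surj surj_f_inv_f)
    then have "map F (map (inv F \<circ> G) vs) = map G vs" for vs
      by (metis map_map)
    then have "\<forall>i\<le>k. \<forall>vs. length vs = 4 + i \<longrightarrow> B i (map (inv F \<circ> G) vs) = nabla_curvature g i P vs"
      unfolding B_def using G(3) by (simp only:)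
    moreover have "linear (inv F \<circ> G)" "bij (inv F \<circ> G)"
      using inv G linear_compose bij_comp by blast+
    ultimately show ?thesis by blast
  qed
  show ?thesis
    unfolding weakly_curvature_homogeneous_def curvature_model_def using 1 2 3 by blast
qed


subsection \<open>The metric\<close>

text \<open>
  The coordinates x, y, z1, z2, y-tilde, x-tilde are the components 1, ..., 6, in this order; in
  the index type \<^typ>\<open>6\<close>, the numerals \<open>6\<close> and \<open>0\<close> denote the same element.
\<close>

definition metric_6f :: "(real \<Rightarrow> real) \<Rightarrow> (real ^ 6) metric" where
  "metric_6f f P u v =
     (u $ 1 * v $ 6 + u $ 6 * v $ 1) + (u $ 2 * v $ 5 + u $ 5 * v $ 2)
     + u $ 3 * v $ 3 + u $ 4 * v $ 4
     - 2 * (P $ 2 * P $ 3 + f (P $ 2) * P $ 4) * (u $ 1 * v $ 1)"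


subsection \<open>Well-definedness\<close>

lemma smooth_dir_deriv: "smooth F \<Longrightarrow> smooth (dir_deriv u F)"
  unfolding smooth_def by (metis fold_simps(2))

lemma smooth_imp_differentiable: "smooth F \<Longrightarrow> F differentiable (at P)"
  unfolding smooth_def by (metis fold_simps(1))

lemma nondegenerate_represent:
  fixes B :: "'a::euclidean_space \<Rightarrow> 'a \<Rightarrow> real"
  assumes B: "bilinear B" and nd: "\<And>u. (\<And>v. B u v = 0) \<Longrightarrow> u = 0" and p: "linear p"
  shows "\<exists>!x. \<forall>w. B x w = p w"
proof -
  define L where "L x = (\<Sum>b\<in>Basis. B x b *\<^sub>R b)" for x
  have linB: "linear (\<lambda>x. B x w)" "linear (B x)" for x w
    using B unfolding bilinear_def by auto
  have ext: "(\<forall>w. B x w = q w) \<longleftrightarrow> (\<forall>b\<in>Basis. B x b = q b)" if "linear q" for x q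
    using linear_eq_stdbasis[OF linB(2) that] by (auto simp: fun_eq_iff)
  have L: "linear L"
    unfolding L_def
    by (intro linearI)
      (simp_all add: linear_add[OF linB(1)] linear_scale[OF linB(1)] scaleR_left_distrib
        sum.distrib scaleR_sum_right)
  have Lb: "L x \<bullet> b = B x b" if "b \<in> Basis" for x b
    using that unfolding L_def by simp
  have zero: "x = 0" if "L x = 0" for x
  proof (rule nd)
    have "\<forall>b\<in>Basis. B x b = 0" using that Lb by (metis inner_zero_left)
    then show "B x v = 0" for v using ext[of "\<lambda>_. 0" x] by (auto simp: linear_iff)
  qed
  then have inj: "inj L"
    using L linear_injective_0 by blast
  then obtain x where x: "L x = (\<Sum>b\<in>Basis. p b *\<^sub>R b)"
    using linear_injective_imp_surjective[OF L] by (metis surjD)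
  have "\<forall>b\<in>Basis. B x b = p b"
    using x Lb by (metis inner_sum_left_Basis)
  then have ex: "\<forall>w. B x w = p w" using ext[OF p] by blast
  moreover have "y = x" if "\<forall>w. B y w = p w" for y
  proof -
    have "L y = L x" using that ex unfolding L_def by simp
    then show ?thesis using inj by (auto dest: injD)
  qed
  ultimately show ?thesis by blast
qed

theorem levi_civita_unique_exists:
  fixes g :: "'a::euclidean_space metric"
  assumes "pseudo_riemannian g"
  shows "\<exists>!\<Gamma>. is_levi_civita g \<Gamma>"
proof -
  have bil: "bilinear (g P)" and sym: "g P u v = g P v u"
    and nd: "(\<And>v. g P u v = 0) \<Longrightarrow> u = 0" and sm: "smooth (\<lambda>P. g P u v)" for P u v
    using assms unfolding pseudo_riemannian_def by blast+
  note lin = bilinear_ladd[OF bil] bilinear_radd[OF bil] bilinear_lmul[OF bil] bilinear_rmul[OF bil]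
  define D where "D u v w P = dir_deriv u (\<lambda>Q. g Q v w) P" for u v w P
  have dif: "(\<lambda>Q. g Q u v) differentiable (at P)" for u v P
    by (rule smooth_imp_differentiable[OF sm])
  note hd = frechet_derivative_works[THEN iffD1, OF dif]
  have D1: "linear (\<lambda>u. D u v w P)" for v w P
    unfolding D_def dir_deriv_def using linear_frechet_derivative[OF dif] .
  have Dsym: "D u v w P = D u w v P" for u v w P
    unfolding D_def by (simp add: sym[of _ v w])
  have D3: "linear (\<lambda>w. D u v w P)" for u v P
  proof (rule linearI)
    fix a b c
    have "((\<lambda>Q. g Q v a + g Q v b) has_derivative
        (\<lambda>h. frechet_derivative (\<lambda>Q. g Q v a) (at P) h + frechet_derivative (\<lambda>Q. g Q v b) (at P) h)) (at P)"
      by (intro has_derivative_add hd)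
    from frechet_derivative_at[OF this] show "D u v (a + b) P = D u v a P + D u v b P"
      unfolding D_def dir_deriv_def by (simp add: lin fun_eq_iff)
    have "((\<lambda>Q. c *\<^sub>R g Q v a) has_derivative
        (\<lambda>h. c *\<^sub>R frechet_derivative (\<lambda>Q. g Q v a) (at P) h)) (at P)"
      by (intro has_derivative_scaleR_right hd)
    from frechet_derivative_at[OF this] show "D u v (c *\<^sub>R a) P = c *\<^sub>R D u v a P"
      unfolding D_def dir_deriv_def by (simp add: lin fun_eq_iff)
  qed
  have D2: "linear (\<lambda>v. D u v w P)" for u w P
    using D3[of u w P] by (simp add: Dsym[of u _ w])
  define K where "K P u v w = (D u v w P + D v u w P - D w u v P) / 2" for P u v w
  have Klin: "linear (\<lambda>u. K P u v w)" "linear (\<lambda>v. K P u v w)" "linear (\<lambda>w. K P u v w)" for P u v w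
    unfolding K_def
    by (intro linearI;
        simp add: linear_add[OF D1] linear_add[OF D2] linear_add[OF D3]
          linear_scale[OF D1] linear_scale[OF D2] linear_scale[OF D3] field_simps)+
  have ex1: "\<exists>!x. \<forall>w. g P x w = K P u v w" for P u v
    by (rule nondegenerate_represent[OF bil nd Klin(3)])
  define C where "C P u v = (THE x. \<forall>w. g P x w = K P u v w)" for P u v
  have C: "g P (C P u v) w = K P u v w" for P u v w
    using theI'[OF ex1] unfolding C_def by blast
  have CI: "C P u v = x" if "\<And>w. g P x w = K P u v w" for P u v x
    using ex1[of P u v] C that by blast
  have "is_levi_civita g C"
    unfolding is_levi_civita_def
  proof (intro conjI allI)
    fix P
    show "bilinear (C P)"
      unfolding bilinear_def
      by (intro conjI allI linearI; rule CI;
          simp add: lin C linear_add[OF Klin(1)] linear_add[OF Klin(2)]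
            linear_scale[OF Klin(1)] linear_scale[OF Klin(2)])
  next
    fix P u v
    show "C P u v = C P v u"
      by (rule CI) (simp add: C K_def Dsym[of _ u v] add.commute)
  next
    fix P u v w
    have "g P (C P u v) w + g P v (C P u w) = K P u v w + K P u w v"
      using C sym by metis
    also have "\<dots> = D u v w P"
      unfolding K_def using Dsym[of u v w P] Dsym[of v u w P] Dsym[of w u v P] by (simp add: field_simps)
    finally show "dir_deriv u (\<lambda>Q. g Q v w) P = g P (C P u v) w + g P v (C P u w)"
      by (simp add: D_def)
  qed
  moreover have "G = C" if G: "is_levi_civita g G" for G
  proof (intro ext)
    fix P u v
    have m: "D a b c P = g P (G P a b) c + g P b (G P a c)" and s: "G P a b = G P b a" for a b c
      using G unfolding is_levi_civita_def D_def by blast+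
    have "g P (G P u v) w = K P u v w" for w
      unfolding K_def m using s[of u v] s[of u w] s[of v w] sym[of P] by (simp add: field_simps)
    then show "G P u v = C P u v" using CI by metis
  qed
  ultimately show ?thesis by blast
qed

inductive_set poly_in :: "(real \<Rightarrow> real) \<Rightarrow> (real ^ 6 \<Rightarrow> real) set" for f where
  const: "(\<lambda>_. c) \<in> poly_in f"
| coord: "(\<lambda>P. P $ i) \<in> poly_in f"
| deriv: "(\<lambda>P. (deriv ^^ n) f (P $ 2)) \<in> poly_in f"
| add: "F \<in> poly_in f \<Longrightarrow> G \<in> poly_in f \<Longrightarrow> (\<lambda>P. F P + G P) \<in> poly_in f"
| mult: "F \<in> poly_in f \<Longrightarrow> G \<in> poly_in f \<Longrightarrow> (\<lambda>P. F P * G P) \<in> poly_in f"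

lemma poly_in_derivative:
  assumes f: "\<And>n y. (deriv ^^ n) f field_differentiable (at y)" and "F \<in> poly_in f"
  shows "\<exists>D. (\<forall>P. (F has_derivative (\<lambda>u. D u P)) (at P)) \<and> (\<forall>u. D u \<in> poly_in f)"
  using assms(2)
proof induction
  case (const c)
  show ?case
    by (rule exI[of _ "\<lambda>u P. 0"]) (auto intro: poly_in.const)
next
  case (coord i)
  show ?case
    by (rule exI[of _ "\<lambda>u P. u $ i"])
      (auto intro: poly_in.const bounded_linear_imp_has_derivative bounded_linear_vec_nth)
next
  case (deriv n)
  have "((\<lambda>P. (deriv ^^ n) f (P $ 2)) has_derivative (\<lambda>u. (deriv ^^ Suc n) f (P $ 2) * u $ 2)) (at P)"
    for P :: "real ^ 6"
  proof -
    have 1: "((deriv ^^ n) f has_derivative (\<lambda>h. (deriv ^^ Suc n) f (P $ 2) * h)) (at (P $ 2))"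
      using f[of n "P $ 2"] by (simp add: field_differentiable_derivI has_field_derivative_imp_has_derivative)
    have 2: "((\<lambda>P. P $ 2) has_derivative (\<lambda>u. u $ 2)) (at P)"
      by (intro bounded_linear_imp_has_derivative bounded_linear_vec_nth)
    show ?thesis
      using has_derivative_compose[OF 2 1] by simp
  qed
  moreover have "(\<lambda>P. (deriv ^^ Suc n) f (P $ 2) * u $ 2) \<in> poly_in f" for u :: "real ^ 6"
    by (rule poly_in.mult[OF poly_in.deriv poly_in.const])
  ultimately show ?case
    by (intro exI[of _ "\<lambda>u P. (deriv ^^ Suc n) f (P $ 2) * u $ 2"]) blast
next
  case (add F G)
  then obtain D E where "\<forall>P. (F has_derivative (\<lambda>u. D u P)) (at P)" "\<forall>u. D u \<in> poly_in f"
    "\<forall>P. (G has_derivative (\<lambda>u. E u P)) (at P)" "\<forall>u. E u \<in> poly_in f" by blast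
  note DE = this
  have "((\<lambda>P. F P + G P) has_derivative (\<lambda>u. D u P + E u P)) (at P)" for P
    using DE by (intro has_derivative_add) blast+
  moreover have "(\<lambda>P. D u P + E u P) \<in> poly_in f" for u
    by (rule poly_in.add) (use DE in blast)+
  ultimately show ?case
    by (intro exI[of _ "\<lambda>u P. D u P + E u P"]) blast
next
  case (mult F G)
  then obtain D E where "\<forall>P. (F has_derivative (\<lambda>u. D u P)) (at P)" "\<forall>u. D u \<in> poly_in f"
    "\<forall>P. (G has_derivative (\<lambda>u. E u P)) (at P)" "\<forall>u. E u \<in> poly_in f" by blast
  note DE = this
  have "((\<lambda>P. F P * G P) has_derivative (\<lambda>u. F P * E u P + D u P * G P)) (at P)" for P
    using DE by (intro has_derivative_mult) blast+
  moreover have "(\<lambda>P. F P * E u P + D u P * G P) \<in> poly_in f" for u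
    by (intro poly_in.add[of "\<lambda>P. F P * E u P"] poly_in.mult) (use DE mult.hyps in blast)+
  ultimately show ?case
    by (intro exI[of _ "\<lambda>u P. F P * E u P + D u P * G P"]) blast
qed

lemma poly_in_smooth:
  assumes f: "\<And>n y. (deriv ^^ n) f field_differentiable (at y)" and "F \<in> poly_in f"
  shows "smooth F"
proof -
  have "fold dir_deriv us F \<in> poly_in f" for us
    using assms(2)
  proof (induction us arbitrary: F)
    case (Cons u us)
    obtain D where D: "\<forall>P. (F has_derivative (\<lambda>u. D u P)) (at P)" "\<forall>u. D u \<in> poly_in f"
      using poly_in_derivative[OF f Cons.prems] by blast
    have "dir_deriv u F = D u"
      unfolding dir_deriv_def using frechet_derivative_at[OF D(1)[rule_format]] by (metis (lifting) ext)
    then show ?case using Cons.IH D(2) by simp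
  qed simp
  then show ?thesis
    unfolding smooth_def differentiable_def using poly_in_derivative[OF f] by blast
qed

theorem pseudo_riemannian_metric_6f:
  assumes f: "\<And>n y. (deriv ^^ n) f field_differentiable (at y)"
  shows "pseudo_riemannian (metric_6f f)"
  unfolding pseudo_riemannian_def
proof (intro conjI allI impI)
  fix P
  show "bilinear (metric_6f f P)"
    unfolding bilinear_def metric_6f_def
    by (intro conjI allI linearI) (simp_all add: algebra_simps)
next
  fix P u v
  show "metric_6f f P u v = metric_6f f P v u"
    unfolding metric_6f_def by (simp add: algebra_simps)
next
  fix P u assume z: "\<forall>v. metric_6f f P u v = 0"
  have ne: "(1::6) \<noteq> 2" "(1::6) \<noteq> 3" "(1::6) \<noteq> 4" "(1::6) \<noteq> 5" "(1::6) \<noteq> 6" "(2::6) \<noteq> 3"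
    "(2::6) \<noteq> 4" "(2::6) \<noteq> 5" "(2::6) \<noteq> 6" "(3::6) \<noteq> 4" "(3::6) \<noteq> 5" "(3::6) \<noteq> 6" "(4::6) \<noteq> 5"
    "(4::6) \<noteq> 6" "(5::6) \<noteq> 6"
    by simp_all
  note s = metric_6f_def axis_def ne ne[symmetric]
  have u: "u $ 1 = 0" "u $ 2 = 0" "u $ 3 = 0" "u $ 4 = 0" "u $ 5 = 0"
    using z[rule_format, of "axis 6 1"] z[rule_format, of "axis 5 1"] z[rule_format, of "axis 3 1"]
      z[rule_format, of "axis 4 1"] z[rule_format, of "axis 2 1"]
    by (simp_all add: s)
  moreover have "u $ 6 = 0"
    using z[rule_format, of "axis 1 1"] u by (simp add: s)
  moreover have "i = 1 \<or> i = 2 \<or> i = 3 \<or> i = 4 \<or> i = 5 \<or> i = 6" for i :: 6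
  proof (induct i)
    case (of_int z)
    then have "z = 0 \<or> z = 1 \<or> z = 2 \<or> z = 3 \<or> z = 4 \<or> z = 5" by auto
    then show ?case by auto
  qed
  ultimately have "u $ i = 0" for i
    by metis
  then show "u = 0" by (simp add: vec_eq_iff)
next
  fix u v
  have "(\<lambda>P. metric_6f f P u v) =
    (\<lambda>P. (u $ 1 * v $ 6 + u $ 6 * v $ 1 + (u $ 2 * v $ 5 + u $ 5 * v $ 2) + u $ 3 * v $ 3 + u $ 4 * v $ 4)
      + (- 2 * (u $ 1 * v $ 1)) * (P $ 2 * P $ 3 + (deriv ^^ 0) f (P $ 2) * P $ 4))"
    unfolding metric_6f_def by (auto simp: algebra_simps)
  also have "\<dots> \<in> poly_in f"
    by (intro poly_in.intros)
  finally show "smooth (\<lambda>P. metric_6f f P u v)"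
    using poly_in_smooth[OF f] by blast
qed

end

theory Submission
  imports Defs
begin

text \<open>
  Write \<open>h = y z1 + f(y) z2\<close>, so that \<open>g\<close> is the flat metric minus
  \<open>2 h dx^2\<close>, where \<open>h\<close> is independent of \<open>x\<close>.  The Christoffel symbols are built from \<open>dh\<close> and have no \<open>x\<close>- or
  \<open>y\<close>-component; hence \<open>dx\<close> is parallel, all quadratic terms cancel, and the curvature is linear in
  \<open>h\<close>: up to sign, \<open>R\<close> is the Kulkarni-Nomizu product of \<open>dx^2\<close> with the Hessian of \<open>h\<close>, and
  \<open>\<nabla>R\<close> is the same product with the third derivative of \<open>h\<close>
  (\<open>curvature_metric_6f\<close>, \<open>nabla_curvature_metric_6f\<close>).

  \<^bold>\<open>Weak homogeneity.\<close>  At a point, \<open>D^2 h = 2 dy (dz1 + f' dz2) + f'' z2 dy^2\<close> and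
  \<open>D^3 h = 3 f'' dy^2 dz2 + f''' z2 dy^3\<close>, with juxtaposition the symmetric product.  Adding a
  multiple of \<open>dy\<close> to the factor \<open>dz1 + f' dz2\<close> absorbs the term in \<open>dy^2\<close>, and adding one to
  \<open>f'' dz2\<close> absorbs the term in \<open>dy^3\<close>.  As \<open>f'' > 0\<close>, the two resulting covectors can replace
  \<open>dz1\<close> and \<open>dz2\<close> in the coordinate coframe.  In the new coframe both tensors have constant
  coefficients, namely those that belong to the Hessian of \<open>y z1\<close> and to the third derivative of
  \<open>y^2 z2 / 2\<close> (\<open>weakly_curvature_homogeneous_metric_6f\<close>).

  \<^bold>\<open>Failure of homogeneity.\<close>  The change of coframe is not isometric, because the directions of
  \<open>dz1 + f' dz2\<close> and \<open>f'' dz2\<close> in the Euclidean \<open>z\<close>-plane enclose an angle that depends on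
  \<open>f'\<close>.  This angle is an invariant: the vectors annihilated by \<open>R\<close> are spanned, modulo null
  vectors orthogonal to the \<open>z\<close>-plane, by \<open>\<partial>z2 - f' \<partial>z1\<close>, and those annihilated by
  \<open>\<nabla>R\<close> (in a slot other than that of the derivative) by \<open>\<partial>z1\<close>.  A map that preserves \<open>g\<close>, \<open>R\<close>
  and \<open>\<nabla>R\<close> preserves both spaces, hence the angle between these lines, hence \<open>(f')^2\<close>
  (\<open>curvature_homogeneous_imp_slope_square_eq\<close>).  But \<open>f'\<close> is strictly increasing, so its
  square cannot be constant.
\<close>

section \<open>The index type\<close>

lemma index_6_cases: "i = 1 \<or> i = 2 \<or> i = 3 \<or> i = 4 \<or> i = 5 \<or> i = (6::6)"
proof (induct i)
  case (of_int z)
  then have "z = 0 \<or> z = 1 \<or> z = 2 \<or> z = 3 \<or> z = 4 \<or> z = 5" by auto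
  then show ?case by auto
qed

lemma index_6_neq:
  "(1::6) \<noteq> 2" "(1::6) \<noteq> 3" "(1::6) \<noteq> 4" "(1::6) \<noteq> 5" "(1::6) \<noteq> 6"
  "(2::6) \<noteq> 3" "(2::6) \<noteq> 4" "(2::6) \<noteq> 5" "(2::6) \<noteq> 6" "(3::6) \<noteq> 4"
  "(3::6) \<noteq> 5" "(3::6) \<noteq> 6" "(4::6) \<noteq> 5" "(4::6) \<noteq> 6" "(5::6) \<noteq> 6"
  by simp_all

lemma vec_eq_iff_6:
  "u = v \<longleftrightarrow> u $ 1 = v $ 1 \<and> u $ 2 = v $ 2 \<and> u $ 3 = v $ 3 \<and> u $ 4 = v $ 4 \<and> u $ 5 = v $ 5 \<and> u $ 6 = v $ 6"
  for u v :: "'a ^ 6"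
proof (intro iffI)
  assume *: "u $ 1 = v $ 1 \<and> u $ 2 = v $ 2 \<and> u $ 3 = v $ 3 \<and> u $ 4 = v $ 4 \<and> u $ 5 = v $ 5 \<and> u $ 6 = v $ 6"
  have "u $ i = v $ i" for i
    using index_6_cases[of i] by (elim disjE) (simp_all only: *)
  then show "u = v" by (simp add: vec_eq_iff)
qed (simp only: simp_thms)

lemmas axis_6_nth = axis_def index_6_neq index_6_neq[symmetric]


section \<open>The potential and its derivatives\<close>

definition potential :: "(real \<Rightarrow> real) \<Rightarrow> real ^ 6 \<Rightarrow> real" where
  "potential f P = P $ 2 * P $ 3 + f (P $ 2) * P $ 4"

definition d_potential :: "(real \<Rightarrow> real) \<Rightarrow> real ^ 6 \<Rightarrow> real ^ 6 \<Rightarrow> real" where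
  "d_potential f P u = (P $ 3 + deriv f (P $ 2) * P $ 4) * u $ 2 + P $ 2 * u $ 3 + f (P $ 2) * u $ 4"

definition d2_potential :: "(real \<Rightarrow> real) \<Rightarrow> real ^ 6 \<Rightarrow> real ^ 6 \<Rightarrow> real ^ 6 \<Rightarrow> real" where
  "d2_potential f P u v =
     deriv (deriv f) (P $ 2) * P $ 4 * (u $ 2 * v $ 2) + (u $ 2 * v $ 3 + u $ 3 * v $ 2)
     + deriv f (P $ 2) * (u $ 2 * v $ 4 + u $ 4 * v $ 2)"

definition d3_potential :: "(real \<Rightarrow> real) \<Rightarrow> real ^ 6 \<Rightarrow> real ^ 6 \<Rightarrow> real ^ 6 \<Rightarrow> real ^ 6 \<Rightarrow> real" where
  "d3_potential f P e u v =
     deriv (deriv (deriv f)) (P $ 2) * P $ 4 * (e $ 2 * u $ 2 * v $ 2)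
     + deriv (deriv f) (P $ 2) * (e $ 4 * u $ 2 * v $ 2 + e $ 2 * u $ 4 * v $ 2 + e $ 2 * u $ 2 * v $ 4)"

lemma dir_deriv_eqI: "(F has_derivative D) (at P) \<Longrightarrow> dir_deriv u F P = D u"
  unfolding dir_deriv_def by (metis frechet_derivative_at)

lemma has_derivative_nth: "((\<lambda>P. P $ i) has_derivative (\<lambda>u. u $ i)) (at P)" for P :: "real ^ 'n"
  by (intro bounded_linear_imp_has_derivative bounded_linear_vec_nth)

lemma has_derivative_fun_nth:
  fixes h :: "real \<Rightarrow> real" and P :: "real ^ 'n"
  assumes "h field_differentiable (at (P $ i))"
  shows "((\<lambda>P. h (P $ i)) has_derivative (\<lambda>u. deriv h (P $ i) * u $ i)) (at P)"
  using has_derivative_compose[OF has_derivative_nth[of i P], of h "\<lambda>t. deriv h (P $ i) * t"]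
    assms by (simp add: field_differentiable_derivI has_field_derivative_imp_has_derivative)

context
  fixes f :: "real \<Rightarrow> real"
  assumes f: "\<And>n y. (deriv ^^ n) f field_differentiable (at y)"
begin

lemma smooth_derivs:
  "f field_differentiable (at y)" "deriv f field_differentiable (at y)"
  "deriv (deriv f) field_differentiable (at y)"
  using f[of 0] f[of 1] f[of 2] by (simp_all add: numeral_2_eq_2)

text \<open>
  The outer function in \<open>has_derivative_fun_nth\<close> is fixed to \<open>f\<close> or one of its derivatives, since
  for a variable \<open>h\<close> the pattern \<open>h (P $ i)\<close> is a higher-order unification problem with too many
  solutions for backward search.
\<close>

lemmas has_derivative_potential_intros =
  has_derivative_add has_derivative_mult has_derivative_const has_derivative_nth
  smooth_derivs[THEN has_derivative_fun_nth]

lemma has_derivative_potential: "(potential f has_derivative d_potential f P) (at P)"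
  unfolding potential_def[abs_def] d_potential_def[abs_def]
  by (rule has_derivative_eq_rhs,
      (rule has_derivative_potential_intros)+)
    (simp add: fun_eq_iff algebra_simps)

lemma has_derivative_d_potential:
  "((\<lambda>P. d_potential f P u) has_derivative (\<lambda>e. d2_potential f P e u)) (at P)"
  unfolding d_potential_def d2_potential_def
  by (rule has_derivative_eq_rhs,
      (rule has_derivative_potential_intros)+)
    (simp add: fun_eq_iff algebra_simps)

lemma has_derivative_d2_potential:
  "((\<lambda>P. d2_potential f P u v) has_derivative (\<lambda>e. d3_potential f P e u v)) (at P)"
  unfolding d2_potential_def d3_potential_def
  by (rule has_derivative_eq_rhs,
      (rule has_derivative_potential_intros)+)
    (simp add: fun_eq_iff algebra_simps)

end

section \<open>The Levi-Civita connection\<close>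

lemma metric_6f_potential:
  "metric_6f f P u v =
     (u $ 1 * v $ 6 + u $ 6 * v $ 1) + (u $ 2 * v $ 5 + u $ 5 * v $ 2)
     + u $ 3 * v $ 3 + u $ 4 * v $ 4 - 2 * potential f P * (u $ 1 * v $ 1)"
  unfolding metric_6f_def potential_def ..

text \<open>
  The vector that represents \<open>\<phi>\<close> with respect to the metric, for covectors \<open>\<phi>\<close> in the span of
  \<open>dy\<close>, \<open>dz1\<close> and \<open>dz2\<close>; raising the index turns \<open>dy\<close> into the fifth coordinate vector.
  The potential enters the metric only through \<open>dx^2\<close>, so \<open>sharp\<close> is the same at all points.
\<close>

definition sharp :: "(real ^ 6 \<Rightarrow> real) \<Rightarrow> real ^ 6" where
  "sharp \<phi> = \<phi> (axis 3 1) *\<^sub>R axis 3 1 + \<phi> (axis 4 1) *\<^sub>R axis 4 1 + \<phi> (axis 2 1) *\<^sub>R axis 5 1"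

text \<open>
  The Koszul formula for a flat metric minus \<open>2 h dx^2\<close> gives
  \<open>g (\<Gamma> u v) w = dx u dx v dh w - dh u dx v dx w - dh v dx u dx w\<close>, and \<open>dx\<close> is represented by
  the sixth coordinate vector.
\<close>

definition christoffel_6f :: "(real \<Rightarrow> real) \<Rightarrow> (real ^ 6) connection" where
  "christoffel_6f f P u v =
     (u $ 1 * v $ 1) *\<^sub>R sharp (d_potential f P)
     - (d_potential f P u * v $ 1 + d_potential f P v * u $ 1) *\<^sub>R axis 6 1"

lemma sharp_nth:
  "sharp \<phi> $ 1 = 0" "sharp \<phi> $ 2 = 0" "sharp \<phi> $ 3 = \<phi> (axis 3 1)"
  "sharp \<phi> $ 4 = \<phi> (axis 4 1)" "sharp \<phi> $ 5 = \<phi> (axis 2 1)" "sharp \<phi> $ 6 = 0"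
  unfolding sharp_def by (simp_all add: axis_6_nth)

lemma christoffel_6f_nth:
  "christoffel_6f f P u v $ 1 = 0"
  "christoffel_6f f P u v $ 2 = 0"
  "christoffel_6f f P u v $ 3 = u $ 1 * v $ 1 * P $ 2"
  "christoffel_6f f P u v $ 4 = u $ 1 * v $ 1 * f (P $ 2)"
  "christoffel_6f f P u v $ 5 = u $ 1 * v $ 1 * (P $ 3 + deriv f (P $ 2) * P $ 4)"
  "christoffel_6f f P u v $ 6 = - (d_potential f P u * v $ 1 + d_potential f P v * u $ 1)"
  unfolding christoffel_6f_def
  by (simp_all add: sharp_nth axis_6_nth d_potential_def)

context
  fixes f :: "real \<Rightarrow> real"
  assumes f: "\<And>n y. (deriv ^^ n) f field_differentiable (at y)"
begin

text \<open>
  In the compatibility with the metric, \<open>potential f P\<close> itself occurs only as a factor of the first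
  component of \<open>\<Gamma>\<close>, which is zero; the rest is a polynomial identity in the components.
\<close>

lemma levi_civita_metric_6f: "levi_civita (metric_6f f) = christoffel_6f f"
proof -
  have "is_levi_civita (metric_6f f) (christoffel_6f f)"
    unfolding is_levi_civita_def
  proof (intro conjI allI)
    show "bilinear (christoffel_6f f P)" for P
      unfolding bilinear_def
      by (intro conjI allI linearI)
        (simp_all add: vec_eq_iff_6 christoffel_6f_nth d_potential_def algebra_simps)
    show "christoffel_6f f P u v = christoffel_6f f P v u" for P u v
      by (simp add: vec_eq_iff_6 christoffel_6f_nth algebra_simps)
    fix P u v w
    have "((\<lambda>Q. metric_6f f Q v w) has_derivative
        (\<lambda>e. - 2 * d_potential f P e * (v $ 1 * w $ 1))) (at P)"
      unfolding metric_6f_potential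
      by (rule has_derivative_eq_rhs, (rule derivative_intros has_derivative_potential[OF f])+)
        (simp add: fun_eq_iff)
    then show "dir_deriv u (\<lambda>Q. metric_6f f Q v w) P =
        metric_6f f P (christoffel_6f f P u v) w + metric_6f f P v (christoffel_6f f P u w)"
      unfolding metric_6f_potential
      by (simp add: dir_deriv_eqI christoffel_6f_nth d_potential_def algebra_simps)
  qed
  then show ?thesis
    unfolding levi_civita_def
    by (rule the1_equality[OF levi_civita_unique_exists[OF pseudo_riemannian_metric_6f[OF f]]])
qed

end

section \<open>The curvature tensor and its covariant derivative\<close>

text \<open>
  Up to sign, the Kulkarni-Nomizu product of \<open>dx \<otimes> dx\<close> with the bilinear form \<open>h\<close>.
\<close>

definition kn_dx :: "(real ^ 6 \<Rightarrow> real ^ 6 \<Rightarrow> real) \<Rightarrow> real ^ 6 \<Rightarrow> real ^ 6 \<Rightarrow> real ^ 6 \<Rightarrow> real ^ 6 \<Rightarrow> real" where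
  "kn_dx h a b c d =
     b $ 1 * c $ 1 * h a d - b $ 1 * d $ 1 * h a c - a $ 1 * c $ 1 * h b d + a $ 1 * d $ 1 * h b c"

context
  fixes f :: "real \<Rightarrow> real"
  assumes f: "\<And>n y. (deriv ^^ n) f field_differentiable (at y)"
begin

lemma has_derivative_christoffel_6f:
  "((\<lambda>P. christoffel_6f f P u v) has_derivative (\<lambda>e.
     (u $ 1 * v $ 1) *\<^sub>R sharp (d2_potential f P e)
     - (d2_potential f P e u * v $ 1 + d2_potential f P e v * u $ 1) *\<^sub>R axis 6 1)) (at P)"
  unfolding christoffel_6f_def sharp_def
  by (rule has_derivative_eq_rhs, (rule derivative_intros has_derivative_d_potential[OF f])+)
    (simp add: fun_eq_iff algebra_simps)

text \<open>
  In \<open>\<Gamma> u (\<Gamma> v w)\<close> only the term \<open>- dh (\<Gamma> v w) dx u\<close> survives, because \<open>dx (\<Gamma> v w) = 0\<close>.  It is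
  symmetric in \<open>u\<close> and \<open>v\<close> and drops out of the curvature, which leaves the derivatives of \<open>\<Gamma>\<close>,
  that is, the Hessian of the potential.
\<close>

lemma curvature_metric_6f:
  "nabla_curvature (metric_6f f) 0 P [a, b, c, d] = kn_dx (d2_potential f P) a b c d"
proof -
  let ?\<Gamma> = "christoffel_6f f"
  have cov: "cov_deriv ?\<Gamma> v (\<lambda>_. w) = (\<lambda>Q. ?\<Gamma> Q v w)" for v w
    by (simp add: fun_eq_iff cov_deriv_def dir_deriv_def)
  have cov2: "cov_deriv ?\<Gamma> u (cov_deriv ?\<Gamma> v (\<lambda>_. w)) P =
      (v $ 1 * w $ 1) *\<^sub>R sharp (d2_potential f P u)
      - (d2_potential f P u v * w $ 1 + d2_potential f P u w * v $ 1) *\<^sub>R axis 6 1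
      + ?\<Gamma> P u (?\<Gamma> P v w)" for u v w
    unfolding cov unfolding cov_deriv_def
    by (simp add: dir_deriv_eqI[OF has_derivative_christoffel_6f])
  show ?thesis
    unfolding nabla_curvature.simps levi_civita_metric_6f[OF f] curvature_op_def cov2
    by (simp add: kn_dx_def metric_6f_potential
        christoffel_6f_nth sharp_nth axis_6_nth d_potential_def d2_potential_def algebra_simps)
qed

text \<open>
  The covariant derivative of the Hessian is its derivative corrected by
  \<open>D^2 h (\<Gamma> e u) v + D^2 h u (\<Gamma> e v)\<close>.  Since \<open>\<Gamma> e u\<close> has no \<open>y\<close>-component and \<open>z\<close>-components
  that are multiples of \<open>dx e dx u\<close>, and the Hessian pairs \<open>z\<close>-components only with \<open>dy v\<close>, the
  correction is a multiple of \<open>dx u dy v + dy u dx v\<close>.  The product of \<open>dx^2\<close> with such a form is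
  zero.
\<close>

lemma nabla_curvature_metric_6f:
  "nabla_curvature (metric_6f f) 1 P [a, b, c, d, e] = kn_dx (d3_potential f P e) a b c d"
proof -
  let ?\<Gamma> = "christoffel_6f f P e"
  have "((\<lambda>Q. kn_dx (d2_potential f Q) a b c d) has_derivative
      (\<lambda>e. kn_dx (d3_potential f P e) a b c d)) (at P)"
    unfolding kn_dx_def
    by (rule has_derivative_eq_rhs, (rule derivative_intros has_derivative_d2_potential[OF f])+)
      (simp add: fun_eq_iff)
  note D = dir_deriv_eqI[OF this]
  have "kn_dx (d2_potential f P) (?\<Gamma> a) b c d + kn_dx (d2_potential f P) a (?\<Gamma> b) c d
      + kn_dx (d2_potential f P) a b (?\<Gamma> c) d + kn_dx (d2_potential f P) a b c (?\<Gamma> d) = 0"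
    by (simp add: kn_dx_def d2_potential_def christoffel_6f_nth algebra_simps)
  then have \<Gamma>: "(\<Sum>p<4. nabla_curvature (metric_6f f) 0 P ([a, b, c, d][p := ?\<Gamma> ([a, b, c, d] ! p)])) = 0"
    by (simp add: eval_nat_numeral curvature_metric_6f del: nabla_curvature.simps)
  have "nabla_curvature (metric_6f f) 1 P [a, b, c, d, e] =
      dir_deriv e (\<lambda>Q. nabla_curvature (metric_6f f) 0 Q [a, b, c, d]) P
      - (\<Sum>p<4. nabla_curvature (metric_6f f) 0 P ([a, b, c, d][p := ?\<Gamma> ([a, b, c, d] ! p)]))"
    unfolding One_nat_def nabla_curvature.simps(2) levi_civita_metric_6f[OF f] cov_deriv_tensor_def
    by (simp add: eval_nat_numeral del: nabla_curvature.simps)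
  then show ?thesis
    unfolding \<Gamma> curvature_metric_6f D by simp
qed

end

section \<open>Weak 1-curvature homogeneity\<close>

text \<open>
  The bilinear forms are the second derivative of \<open>y z1\<close> and the contraction with the fifth
  argument of the third derivative of \<open>y^2 z2 / 2\<close>.
\<close>

definition model_6 :: "nat \<Rightarrow> (real ^ 6) list \<Rightarrow> real" where
  "model_6 i vs =
     kn_dx (if i = 0 then (\<lambda>u v. u $ 2 * v $ 3 + u $ 3 * v $ 2)
       else (\<lambda>u v. (vs ! 4) $ 4 * u $ 2 * v $ 2 + (vs ! 4) $ 2 * u $ 4 * v $ 2 + (vs ! 4) $ 2 * u $ 2 * v $ 4))
       (vs ! 0) (vs ! 1) (vs ! 2) (vs ! 3)"

text \<open>
  The divisors count the ways in which the added multiple of \<open>dy\<close> enters the symmetric products: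
  \<open>2 dy (dz1 + f' dz2 + c dy)\<close> contains \<open>2 c dy^2\<close>, to be equal to \<open>f'' z2 dy^2\<close>, and
  \<open>3 dy^2 (f'' dz2 + c dy)\<close> contains \<open>3 c dy^3\<close>, to be equal to \<open>f''' z2 dy^3\<close>.
\<close>

definition model_frame :: "(real \<Rightarrow> real) \<Rightarrow> real ^ 6 \<Rightarrow> real ^ 6 \<Rightarrow> real ^ 6" where
  "model_frame f P u = (\<chi> i.
     if i = 3 then u $ 3 + deriv f (P $ 2) * u $ 4 + deriv (deriv f) (P $ 2) * P $ 4 / 2 * u $ 2
     else if i = 4 then deriv (deriv f) (P $ 2) * u $ 4 + deriv (deriv (deriv f)) (P $ 2) * P $ 4 / 3 * u $ 2
     else u $ i)"

lemma model_frame_nth: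
  "model_frame f P u $ 1 = u $ 1"
  "model_frame f P u $ 2 = u $ 2"
  "model_frame f P u $ 3 = u $ 3 + deriv f (P $ 2) * u $ 4 + deriv (deriv f) (P $ 2) * P $ 4 / 2 * u $ 2"
  "model_frame f P u $ 4 = deriv (deriv f) (P $ 2) * u $ 4 + deriv (deriv (deriv f)) (P $ 2) * P $ 4 / 3 * u $ 2"
  "model_frame f P u $ 5 = u $ 5"
  "model_frame f P u $ 6 = u $ 6"
  unfolding model_frame_def by (simp_all add: index_6_neq index_6_neq[symmetric])

lemma linear_model_frame: "linear (model_frame f P)"
  by (rule linearI) (simp_all add: vec_eq_iff_6 model_frame_nth algebra_simps)

lemma bij_model_frame:
  assumes "deriv (deriv f) (P $ 2) \<noteq> 0"
  shows "bij (model_frame f P)"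
proof -
  have "inj (model_frame f P)"
    unfolding linear_injective_0[OF linear_model_frame]
    using assms by (auto simp: vec_eq_iff_6 model_frame_nth)
  then show ?thesis
    by (simp add: bij_def linear_injective_imp_surjective[OF linear_model_frame])
qed

lemma length_eq_4D: "length vs = 4 \<Longrightarrow> \<exists>a b c d. vs = [a, b, c, d]"
  by (auto simp: eval_nat_numeral length_Suc_conv)

lemma length_eq_5D: "length vs = 5 \<Longrightarrow> \<exists>a b c d e. vs = [a, b, c, d, e]"
  by (auto simp: eval_nat_numeral length_Suc_conv)

lemma multilinear_model_6:
  assumes "i \<le> 1"
  shows "multilinear_form (4 + i) (model_6 i)"
  unfolding multilinear_form_def
proof (intro allI impI)
  fix vs :: "(real ^ 6) list" and p assume *: "length vs = 4 + i" "p < 4 + i"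
  have "i = 0 \<or> i = 1" using assms by auto
  then show "linear (\<lambda>v. model_6 i (vs[p := v]))"
  proof
    assume i: "i = 0"
    then obtain a b c d where "vs = [a, b, c, d]" using * length_eq_4D[of vs] by auto
    moreover have "p \<in> {0, 1, 2, 3}" using * i by auto
    ultimately show ?thesis
      by (intro linearI) (auto simp: i model_6_def kn_dx_def algebra_simps)
  next
    assume i: "i = 1"
    then obtain a b c d e where "vs = [a, b, c, d, e]" using * length_eq_5D[of vs] by auto
    moreover have "p \<in> {0, 1, 2, 3, 4}" using * i by auto
    ultimately show ?thesis
      by (intro linearI) (auto simp: i model_6_def kn_dx_def algebra_simps)
  qed
qed

lemma curvature_symmetries_model_6:
  assumes "i \<le> 1"
  shows "curvature_symmetries i (model_6 i)"
proof -
  have "i = 0 \<or> i = 1" using assms by auto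
  then show ?thesis
    by (auto simp: curvature_symmetries_def model_6_def kn_dx_def length_Suc_conv algebra_simps)
qed

lemma weakly_curvature_homogeneous_metric_6f:
  fixes f :: "real \<Rightarrow> real"
  assumes f: "\<And>n y. (deriv ^^ n) f field_differentiable (at y)"
    and ne: "\<And>y. deriv (deriv f) y \<noteq> 0"
  shows "weakly_curvature_homogeneous 1 (metric_6f f)"
proof (rule weakly_curvature_homogeneousI)
  have "model_6 i (map (model_frame f P) vs) = nabla_curvature (metric_6f f) i P vs"
    if "i \<le> 1" "length vs = 4 + i" for i vs P
  proof -
    have "i = 0 \<or> i = 1" using that by auto
    then show ?thesis
    proof
      assume i: "i = 0"
      with that obtain a b c d where vs: "vs = [a, b, c, d]" using length_eq_4D[of vs] by auto
      show ?thesis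
        unfolding i vs curvature_metric_6f[OF f]
        by (simp add: model_6_def kn_dx_def d2_potential_def model_frame_nth algebra_simps)
    next
      assume i: "i = 1"
      with that obtain a b c d e where vs: "vs = [a, b, c, d, e]" using length_eq_5D[of vs] by auto
      show ?thesis
        unfolding i vs nabla_curvature_metric_6f[OF f]
        by (simp add: model_6_def kn_dx_def d3_potential_def model_frame_nth field_simps)
    qed
  qed
  then show "curvature_model 1 model_6 (metric_6f f)"
    unfolding curvature_model_def
    using multilinear_model_6 curvature_symmetries_model_6 linear_model_frame
      bij_model_frame[OF ne] by blast
qed

section \<open>An isometry invariant of the 1-jet of the curvature\<close>

context
  fixes f :: "real \<Rightarrow> real"
  assumes f: "\<And>n y. (deriv ^^ n) f field_differentiable (at y)"
begin

text \<open>
  The Hessian has the form \<open>2 dy \<xi>\<close> plus a multiple of \<open>dy^2\<close>, with \<open>\<xi> = dz1 + f' dz2\<close>, so \<open>R\<close>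
  depends on its last argument exactly through \<open>dx\<close>, \<open>dy\<close> and \<open>\<xi>\<close>.
\<close>

lemma curvature_kernel_metric_6f:
  "(\<forall>a b c. nabla_curvature (metric_6f f) 0 P [a, b, c, t] = 0) \<longleftrightarrow>
     t $ 1 = 0 \<and> t $ 2 = 0 \<and> t $ 3 + deriv f (P $ 2) * t $ 4 = 0" (is "?L \<longleftrightarrow> ?R")
proof
  assume ?L
  then have *: "kn_dx (d2_potential f P) a b c t = 0" for a b c
    unfolding curvature_metric_6f[OF f] by blast
  show ?R
    using *[of "axis 3 1" "axis 1 1" "axis 2 1"] *[of "axis 3 1" "axis 1 1" "axis 1 1"]
      *[of "axis 2 1" "axis 1 1" "axis 1 1"]
    by (simp add: kn_dx_def d2_potential_def axis_6_nth)
next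
  assume ?R
  then have "t $ 1 = 0" "t $ 2 = 0" "t $ 3 = - deriv f (P $ 2) * t $ 4" by simp_all
  then show ?L
    unfolding curvature_metric_6f[OF f]
    by (simp add: kn_dx_def d2_potential_def algebra_simps)
qed

text \<open>
  In contrast to the Hessian, the third derivative involves \<open>dz1\<close> not at all, and \<open>dz2\<close> with
  coefficient \<open>f''\<close>.
\<close>

lemma nabla_curvature_kernel_metric_6f:
  assumes ne: "deriv (deriv f) (P $ 2) \<noteq> 0"
  shows "(\<forall>a b c e. nabla_curvature (metric_6f f) 1 P [a, b, c, t, e] = 0) \<longleftrightarrow>
     t $ 1 = 0 \<and> t $ 2 = 0 \<and> t $ 4 = 0" (is "?L \<longleftrightarrow> ?R")
proof
  assume ?L
  then have *: "kn_dx (d3_potential f P e) a b c t = 0" for a b c e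
    unfolding nabla_curvature_metric_6f[OF f] by blast
  show ?R
    using *[of "axis 2 1" "axis 4 1" "axis 1 1" "axis 2 1"] *[of "axis 2 1" "axis 4 1" "axis 1 1" "axis 1 1"]
      *[of "axis 2 1" "axis 2 1" "axis 1 1" "axis 1 1"] ne
    by (simp add: kn_dx_def d3_potential_def axis_6_nth)
next
  assume ?R
  then show ?L
    unfolding nabla_curvature_metric_6f[OF f]
    by (simp add: kn_dx_def d3_potential_def)
qed

text \<open>
  The invariant is the angle between the two kernels in the quotient by null directions.  Their
  spanning vectors \<open>m = \<partial>z1\<close> and \<open>n = \<partial>z2 - f' \<partial>z1\<close> satisfy \<open>g m m = 1\<close>, \<open>g m n = - f'\<close> and
  \<open>g n n = 1 + (f')^2\<close>, so the squared cosine is \<open>(f')^2 / (1 + (f')^2)\<close>, an injective function of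
  \<open>(f')^2\<close>.  The sign of the cosine carries no information, as the kernels are not oriented.
\<close>

lemma curvature_homogeneous_imp_slope_square_eq:
  assumes hom: "curvature_homogeneous 1 (metric_6f f)"
    and ne: "\<And>y. deriv (deriv f) y \<noteq> 0"
  shows "(deriv f r)\<^sup>2 = (deriv f s)\<^sup>2"
proof -
  define P Q :: "real ^ 6" where "P = axis 2 r" and "Q = axis 2 s"
  define p q where "p = deriv f r" and "q = deriv f s"
  have P: "deriv f (P $ 2) = p" and Q: "deriv f (Q $ 2) = q"
    by (simp_all add: P_def Q_def p_def q_def axis_def)
  obtain \<Psi> :: "real ^ 6 \<Rightarrow> real ^ 6" where "bij \<Psi>"
    and g: "\<And>u v. metric_6f f Q (\<Psi> u) (\<Psi> v) = metric_6f f P u v"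
    and "\<forall>i\<le>1. \<forall>vs. length vs = 4 + i \<longrightarrow>
      nabla_curvature (metric_6f f) i Q (map \<Psi> vs) = nabla_curvature (metric_6f f) i P vs"
    using hom unfolding curvature_homogeneous_def by blast
  note * = this(3)[rule_format]
  have R: "nabla_curvature (metric_6f f) 0 Q [\<Psi> a, \<Psi> b, \<Psi> c, \<Psi> d] =
      nabla_curvature (metric_6f f) 0 P [a, b, c, d]" for a b c d
    using *[of 0 "[a, b, c, d]"] by (simp del: nabla_curvature.simps)
  have R': "nabla_curvature (metric_6f f) 1 Q [\<Psi> a, \<Psi> b, \<Psi> c, \<Psi> d, \<Psi> e] =
      nabla_curvature (metric_6f f) 1 P [a, b, c, d, e]" for a b c d e
    using *[of 1 "[a, b, c, d, e]"] by (simp del: nabla_curvature.simps)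
  have surj: "\<exists>u. v = \<Psi> u" for v
    using \<open>bij \<Psi>\<close> by (meson bij_is_surj surjD)
  define m n where "m = (axis 3 1 :: real ^ 6)" and "n = (axis 4 1 - p *\<^sub>R axis 3 1 :: real ^ 6)"
  have n: "\<Psi> n $ 1 = 0 \<and> \<Psi> n $ 2 = 0 \<and> \<Psi> n $ 3 + q * \<Psi> n $ 4 = 0"
  proof -
    have "\<forall>a b c. nabla_curvature (metric_6f f) 0 P [a, b, c, n] = 0"
      unfolding curvature_kernel_metric_6f P n_def by (simp add: axis_6_nth)
    then have "\<forall>a b c. nabla_curvature (metric_6f f) 0 Q [a, b, c, \<Psi> n] = 0"
      using R surj by metis
    then show ?thesis
      unfolding curvature_kernel_metric_6f Q .
  qed
  have m: "\<Psi> m $ 1 = 0 \<and> \<Psi> m $ 2 = 0 \<and> \<Psi> m $ 4 = 0"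
  proof -
    have "\<forall>a b c e. nabla_curvature (metric_6f f) 1 P [a, b, c, m, e] = 0"
      unfolding nabla_curvature_kernel_metric_6f[OF ne] m_def by (simp add: axis_6_nth)
    then have "\<forall>a b c e. nabla_curvature (metric_6f f) 1 Q [a, b, c, \<Psi> m, e] = 0"
      using R' surj by metis
    then show ?thesis
      unfolding nabla_curvature_kernel_metric_6f[OF ne] .
  qed
  \<comment> \<open>Modulo the null vectors in components 5 and 6, \<open>\<Psi>\<close> sends \<open>n\<close> to \<open>\<sigma>\<close> times the vector \<open>n\<close>
    belonging to \<open>Q\<close>, and \<open>m\<close> to \<open>\<tau>\<close> times \<open>m\<close>.\<close>
  define \<sigma> \<tau> where "\<sigma> = \<Psi> n $ 4" and "\<tau> = \<Psi> m $ 3"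
  have n3: "\<Psi> n $ 3 = - q * \<sigma>" using n by (simp add: \<sigma>_def)
  have mm: "\<tau>\<^sup>2 = 1" and mn: "q * \<sigma> * \<tau> = p" and nn: "(1 + q\<^sup>2) * \<sigma>\<^sup>2 = 1 + p\<^sup>2"
    using g[of m m] g[of m n] g[of n n] m n n3
    by (simp_all add: metric_6f_def m_def[symmetric] n_def[symmetric] \<tau>_def[symmetric]
        \<sigma>_def[symmetric] power2_eq_square algebra_simps)
      (simp_all add: m_def n_def axis_6_nth algebra_simps)
  have "p\<^sup>2 = q\<^sup>2 * \<sigma>\<^sup>2"
    unfolding mn[symmetric] by (simp add: power_mult_distrib mm)
  with nn have "\<sigma>\<^sup>2 = 1" by (simp add: algebra_simps)
  with \<open>p\<^sup>2 = q\<^sup>2 * \<sigma>\<^sup>2\<close> show ?thesis by (simp add: p_def q_def)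
qed

end

theorem corollary3p3:
  fixes f :: "real \<Rightarrow> real"
  assumes smooth_f: "\<And>n y. (deriv ^^ n) f field_differentiable (at y)"
    and convex_f: "\<And>y. deriv (deriv f) y > 0"
  shows "weakly_curvature_homogeneous 1 (metric_6f f) \<and> \<not> curvature_homogeneous 1 (metric_6f f)"
proof
  have ne: "deriv (deriv f) y \<noteq> 0" for y using convex_f[of y] by simp
  show "weakly_curvature_homogeneous 1 (metric_6f f)"
    by (rule weakly_curvature_homogeneous_metric_6f[OF smooth_f ne])
  show "\<not> curvature_homogeneous 1 (metric_6f f)"
  proof
    assume hom: "curvature_homogeneous 1 (metric_6f f)"
    have "(deriv f has_real_derivative deriv (deriv f) y) (at y)" for y
      using smooth_derivs(2)[OF smooth_f] by (rule field_differentiable_derivI)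
    then have "deriv f a < deriv f b" if "a < b" for a b
      using DERIV_pos_imp_increasing[OF that, of "deriv f"] convex_f by blast
    \<comment> \<open>Three values of \<open>f'\<close> are needed: two distinct ones may be opposite and have equal squares.\<close>
    from this[of 0 1] this[of 1 2] have "deriv f 0 < deriv f 1" "deriv f 1 < deriv f 2" by simp_all
    moreover have "(deriv f 0)\<^sup>2 = (deriv f 1)\<^sup>2" "(deriv f 1)\<^sup>2 = (deriv f 2)\<^sup>2"
      by (rule curvature_homogeneous_imp_slope_square_eq[OF smooth_f hom ne])+
    ultimately show False by (auto simp: power2_eq_iff)
  qed
qed

end
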